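(* If $\mathcal{F}$ and $\mathcal{G}$ are nonprincipal filters on $\omega$, then $\mathcal{F}\otimes\mathcal{G}$ is cofinally equivalent to $\mathcal{F}\times\mathcal{G}^\omega$.
   Context: Filters on $\omega$ are ordered by containment $\supseteq$ (smaller sets are greater); products, including the power $\mathcal{G}^\omega$ of all functions $\omega\to\mathcal{G}$, have the coordinatewise order. Preorders $P$ and $Q$ are cofinally equivalent if there is a preorder $R$ such that $P$ and $Q$ are order isomorphic to cofinal subsets of $R$. Fix a pairing function (bijection) $\langle\cdot,\cdot\rangle$ from $\omega\times\omega$ to $\omega$; for $E\subseteq\omega$ and $i\in\omega$ let $(E)_i=\{j:\langle i,j\rangle\in E\}$. The Fubini product of filters $\mathcal{F},\mathcal{G}$ on $\omega$ is the filter $\mathcal{F}\otimes\mathcal{G}=\{E\subseteq\omega:\{i:(E)_i\in\mathcal{G}\}\in\mathcal{F}\}$ on $\omega$. *)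

theory Defs
  imports Main
begin

definition cofinal_in :: "'a set \<Rightarrow> 'a rel \<Rightarrow> bool" where
  "cofinal_in C r \<longleftrightarrow> C \<subseteq> Field r \<and> (\<forall>x\<in>Field r. \<exists>c\<in>C. (x, c) \<in> r)"

definition order_isomorphic :: "'a rel \<Rightarrow> 'b rel \<Rightarrow> bool" where
  "order_isomorphic r s \<longleftrightarrow>
     (\<exists>f. bij_betw f (Field r) (Field s) \<and>
          (\<forall>x\<in>Field r. \<forall>y\<in>Field r. (x, y) \<in> r \<longleftrightarrow> (f x, f y) \<in> s))"

text \<open>
  HOL cannot quantify over the type carrying the ambient preorder. The disjoint sum of the two
  carrier types is always large enough: see \<open>cofinally_equivalentI\<close> below.
\<close>

definition cofinally_equivalent :: "'a rel \<Rightarrow> 'b rel \<Rightarrow> bool" where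
  "cofinally_equivalent r s \<longleftrightarrow>
     (\<exists>(R :: ('a + 'b) rel) C D. Preorder R \<and> cofinal_in C R \<and> cofinal_in D R \<and>
        order_isomorphic r (Restr R C) \<and> order_isomorphic s (Restr R D))"

lemma cofinally_equivalentI:
  fixes r :: "'a rel" and s :: "'b rel" and R :: "'c rel"
  assumes R: "Preorder R" and C: "cofinal_in C R" and D: "cofinal_in D R"
    and r: "order_isomorphic r (Restr R C)" and s: "order_isomorphic s (Restr R D)"
  shows "cofinally_equivalent r s"
proof -
  have refl: "\<And>x. x \<in> Field R \<Longrightarrow> (x, x) \<in> R"
    using R by (auto simp: preorder_on_def refl_on_def)
  have trans: "\<And>x y z. (x, y) \<in> R \<Longrightarrow> (y, z) \<in> R \<Longrightarrow> (x, z) \<in> R"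
    using R by (auto simp: preorder_on_def dest: transD)
  have CF: "C \<subseteq> Field R" "Field (Restr R C) = C" and DF: "D \<subseteq> Field R" "Field (Restr R D) = D"
    using C D R Refl_Field_Restr2[of R] by (simp_all add: cofinal_in_def preorder_on_def)
  obtain f where f: "bij_betw f (Field r) C"
    and fr: "\<And>x y. x \<in> Field r \<Longrightarrow> y \<in> Field r \<Longrightarrow> (x, y) \<in> r \<longleftrightarrow> (f x, f y) \<in> Restr R C"
    using r unfolding order_isomorphic_def CF(2) by blast
  obtain g where g: "bij_betw g (Field s) D"
    and gs: "\<And>x y. x \<in> Field s \<Longrightarrow> y \<in> Field s \<Longrightarrow> (x, y) \<in> s \<longleftrightarrow> (g x, g y) \<in> Restr R D"
    using s unfolding order_isomorphic_def DF(2) by blast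
  have fC: "f ` Field r = C" and gD: "g ` Field s = D"
    using f g by (auto simp: bij_betw_def)
  define h where "h = case_sum f g"
  define A :: "('a + 'b) set" where "A = Inl ` Field r"
  define B :: "('a + 'b) set" where "B = Inr ` Field s"
  define S where "S = {(x, y). x \<in> A \<union> B \<and> y \<in> A \<union> B \<and> (h x, h y) \<in> R}"
  have hA: "h ` A = C" and hB: "h ` B = D"
    unfolding h_def A_def B_def using fC gD by (auto simp: image_image)
  have hF: "h x \<in> Field R" if "x \<in> A \<union> B" for x
    using that hA hB CF DF by blast
  have reflS: "(x, x) \<in> S" if "x \<in> A \<union> B" for x
    using that hF refl unfolding S_def by blast
  have FS: "Field S = A \<union> B"
  proof
    show "Field S \<subseteq> A \<union> B"
      unfolding S_def Field_def by blast
    show "A \<union> B \<subseteq> Field S"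
      using reflS unfolding Field_def by blast
  qed
  have "Preorder S"
    unfolding preorder_on_def FS
  proof (intro conjI)
    show "S \<subseteq> (A \<union> B) \<times> (A \<union> B)"
      unfolding S_def by blast
    show "refl_on (A \<union> B) S"
      unfolding refl_on_def using reflS by blast
    show "trans S"
      unfolding S_def by (rule transI) (use trans in blast)
  qed
  moreover have "cofinal_in A S"
    unfolding cofinal_in_def FS
  proof (intro conjI ballI)
    fix x assume x: "x \<in> A \<union> B"
    then obtain c where "c \<in> C" "(h x, c) \<in> R"
      using C hF[OF x] by (auto simp: cofinal_in_def)
    then show "\<exists>c\<in>A. (x, c) \<in> S"
      using hA x by (auto simp: S_def)
  qed auto
  moreover have "cofinal_in B S"
    unfolding cofinal_in_def FS
  proof (intro conjI ballI)
    fix x assume x: "x \<in> A \<union> B"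
    then obtain c where "c \<in> D" "(h x, c) \<in> R"
      using D hF[OF x] by (auto simp: cofinal_in_def)
    then show "\<exists>c\<in>B. (x, c) \<in> S"
      using hB x by (auto simp: S_def)
  qed auto
  moreover have "order_isomorphic r (Restr S A)"
    unfolding order_isomorphic_def
  proof (intro exI conjI ballI)
    have "Field (Restr S A) = A"
      using reflS unfolding Field_def by blast
    then show "bij_betw Inl (Field r) (Field (Restr S A))"
      by (auto simp: A_def bij_betw_def)
    show "(x, y) \<in> r \<longleftrightarrow> (Inl x, Inl y) \<in> Restr S A" if "x \<in> Field r" "y \<in> Field r" for x y
      using that fr fC by (auto simp: S_def A_def h_def)
  qed
  moreover have "order_isomorphic s (Restr S B)"
    unfolding order_isomorphic_def
  proof (intro exI conjI ballI)
    have "Field (Restr S B) = B"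
      using reflS unfolding Field_def by blast
    then show "bij_betw Inr (Field s) (Field (Restr S B))"
      by (auto simp: B_def bij_betw_def)
    show "(x, y) \<in> s \<longleftrightarrow> (Inr x, Inr y) \<in> Restr S B" if "x \<in> Field s" "y \<in> Field s" for x y
      using that gs gD by (auto simp: S_def B_def h_def)
  qed
  ultimately show ?thesis
    unfolding cofinally_equivalent_def by (intro exI conjI)
qed

definition prod_order :: "'a rel \<Rightarrow> 'b rel \<Rightarrow> ('a \<times> 'b) rel" where
  "prod_order r s = {((a, b), (a', b')). (a, a') \<in> r \<and> (b, b') \<in> s}"

definition power_order :: "'a rel \<Rightarrow> (nat \<Rightarrow> 'a) rel" where
  "power_order r = {(f, g). \<forall>n. (f n, g n) \<in> r}"

definition filter_sets :: "'a filter \<Rightarrow> 'a set set" where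
  "filter_sets F = {A. eventually (\<lambda>x. x \<in> A) F}"

definition filter_order :: "'a filter \<Rightarrow> 'a set rel" where
  "filter_order F = relation_of (\<lambda>A B. A \<supseteq> B) (filter_sets F)"

text \<open>
  Principal means generated by a single set, not necessarily a singleton. The improper filter
  \<open>bot = principal {}\<close> is thus principal.
\<close>

definition nonprincipal :: "'a filter \<Rightarrow> bool" where
  "nonprincipal F \<longleftrightarrow> (\<nexists>S. F = principal S)"

definition section_at :: "(nat \<times> nat \<Rightarrow> nat) \<Rightarrow> nat set \<Rightarrow> nat \<Rightarrow> nat set" where
  "section_at p E i = {j. p (i, j) \<in> E}"

definition fubini_product :: "(nat \<times> nat \<Rightarrow> nat) \<Rightarrow> nat filter \<Rightarrow> nat filter \<Rightarrow> nat filter" where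
  "fubini_product p F G =
     Abs_filter (\<lambda>P. {i. section_at p {n. P n} i \<in> filter_sets G} \<in> filter_sets F)"

lemma filter_sets_fubini_product:
  "filter_sets (fubini_product p F G) =
     {E. {i. section_at p E i \<in> filter_sets G} \<in> filter_sets F}"
proof -
  have "is_filter (\<lambda>P. {i. section_at p {n. P n} i \<in> filter_sets G} \<in> filter_sets F)"
    unfolding filter_sets_def section_at_def mem_Collect_eq
  proof (rule is_filter.intro)
    fix P Q :: "nat \<Rightarrow> bool"
    assume "\<forall>\<^sub>F i in F. \<forall>\<^sub>F j in G. P (p (i, j))" "\<forall>\<^sub>F i in F. \<forall>\<^sub>F j in G. Q (p (i, j))"
    then show "\<forall>\<^sub>F i in F. \<forall>\<^sub>F j in G. P (p (i, j)) \<and> Q (p (i, j))"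
      by (simp add: eventually_conj_iff)
  next
    fix P Q :: "nat \<Rightarrow> bool"
    assume PQ: "\<forall>x. P x \<longrightarrow> Q x" and P: "\<forall>\<^sub>F i in F. \<forall>\<^sub>F j in G. P (p (i, j))"
    show "\<forall>\<^sub>F i in F. \<forall>\<^sub>F j in G. Q (p (i, j))"
      by (rule eventually_mono[OF P], erule eventually_mono) (simp add: PQ)
  qed simp
  then show ?thesis
    by (simp add: fubini_product_def eventually_Abs_filter filter_sets_def)
qed

end

theory Submission
  imports Defs
begin

text \<open>
  For directed preorders, monotone maps with cofinal image in both directions already give
  cofinal equivalence (Tukey's theorem, \<open>cofinally_equivalent_if_mono_cofinal_maps\<close>), so it
  suffices to find one such map each way between \<open>F \<otimes> G\<close> and \<open>F \<times> G\<^sup>\<omega>\<close>.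

  From \<open>F \<times> G\<^sup>\<omega>\<close> to \<open>F \<otimes> G\<close>, send \<open>(A, B)\<close> to the set whose sections are \<open>B i\<close> for \<open>i \<in> A\<close> and
  empty otherwise. Every \<open>E\<close> in \<open>F \<otimes> G\<close> contains such a set.

  In the other direction, let \<open>A\<close> be the set of indices at which the section of \<open>E\<close> lies in \<open>G\<close>.
  It belongs to \<open>F\<close>, but the sections outside \<open>A\<close> say nothing about \<open>G\<close>, so a whole sequence
  in \<open>G\<close> has to be recovered from the sections over \<open>A\<close>, and monotonically, although \<open>A\<close> shrinks
  along with \<open>E\<close>. Unions of sections do this: send \<open>E\<close> to the pair of \<open>A\<close> and the sequence whose
  \<open>n\<close>-th term is the union of the sections of \<open>E\<close> over all \<open>i \<ge> n\<close> in \<open>A\<close>. As \<open>F\<close> is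
  nonprincipal, \<open>A\<close> is infinite (\<open>infinite_if_nonprincipal\<close>), so each of these unions is over a
  nonempty index set and lies in \<open>G\<close>. To dominate a given pair \<open>(A, C)\<close>, use the set \<open>E\<close> with
  sections \<open>C 0 \<inter> \<dots> \<inter> C i\<close> for \<open>i \<in> A\<close>: then every section that enters the \<open>n\<close>-th union
  is contained in \<open>C n\<close>.
\<close>

section \<open>Cofinal equivalence of directed preorders\<close>

definition directed :: "'a rel \<Rightarrow> bool" where
  "directed r \<longleftrightarrow> (\<forall>x\<in>Field r. \<forall>y\<in>Field r. \<exists>z. (x, z) \<in> r \<and> (y, z) \<in> r)"

text \<open>
  The common extension lives on the disjoint sum: \<open>x\<close> is put below \<open>y\<close> if \<open>h x' \<le> y\<close> for some
  \<open>x' \<ge> x\<close>, and dually with \<open>k\<close>. The two exchange conditions on \<open>h\<close> and \<open>k\<close> ensure that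
  passing to the other side and back creates no new relation inside \<open>r\<close> or \<open>s\<close>.
\<close>

lemma cofinally_equivalent_if_exchange:
  fixes r :: "'a rel" and s :: "'b rel"
  assumes r: "Preorder r" and s: "Preorder s"
    and h: "\<And>x. x \<in> Field r \<Longrightarrow> h x \<in> Field s"
    and k: "\<And>y. y \<in> Field s \<Longrightarrow> k y \<in> Field r"
    and hk: "\<And>x y. x \<in> Field r \<Longrightarrow> (h x, y) \<in> s \<Longrightarrow> (x, k y) \<in> r"
    and kh: "\<And>x y. y \<in> Field s \<Longrightarrow> (k y, x) \<in> r \<Longrightarrow> (y, h x) \<in> s"
  shows "cofinally_equivalent r s"
proof -
  have rr: "(x, x) \<in> r" if "x \<in> Field r" for x
    using r that by (auto simp: preorder_on_def refl_on_def)
  have ss: "(y, y) \<in> s" if "y \<in> Field s" for y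
    using s that by (auto simp: preorder_on_def refl_on_def)
  have tr: "(x, z) \<in> r" if "(x, y) \<in> r" "(y, z) \<in> r" for x y z
    using r that by (auto simp: preorder_on_def dest: transD)
  have ts: "(x, z) \<in> s" if "(x, y) \<in> s" "(y, z) \<in> s" for x y z
    using s that by (auto simp: preorder_on_def dest: transD)
  define U where "U = {(x, y). \<exists>x'. (x, x') \<in> r \<and> (h x', y) \<in> s}"
  define V where "V = {(y, x). \<exists>y'. (y, y') \<in> s \<and> (k y', x) \<in> r}"
  have UV: "(x, z) \<in> r" if U: "(x, y) \<in> U" and V: "(y, z) \<in> V" for x y z
  proof -
    obtain x' where x': "(x, x') \<in> r" "(h x', y) \<in> s"
      using U unfolding U_def by blast
    obtain y' where y': "(y, y') \<in> s" "(k y', z) \<in> r"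
      using V unfolding V_def by blast
    have "(x', k y') \<in> r"
      by (rule hk) (use x' y' ts in \<open>auto simp: Field_def\<close>)
    then show ?thesis
      using x' y' tr by blast
  qed
  have VU: "(y, z) \<in> s" if V: "(y, x) \<in> V" and U: "(x, z) \<in> U" for y x z
  proof -
    obtain y' where y': "(y, y') \<in> s" "(k y', x) \<in> r"
      using V unfolding V_def by blast
    obtain x' where x': "(x, x') \<in> r" "(h x', z) \<in> s"
      using U unfolding U_def by blast
    have "(y', h x') \<in> s"
      by (rule kh) (use x' y' tr in \<open>auto simp: Field_def\<close>)
    then show ?thesis
      using x' y' ts by blast
  qed
  have U1: "(x, y) \<in> U" if "(x, x') \<in> r" "(x', y) \<in> U" for x x' y
    using that tr unfolding U_def by blast
  have U2: "(x, y) \<in> U" if "(x, y') \<in> U" "(y', y) \<in> s" for x y y'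
    using that ts unfolding U_def by blast
  have V1: "(y, x) \<in> V" if "(y, y') \<in> s" "(y', x) \<in> V" for x y y'
    using that ts unfolding V_def by blast
  have V2: "(y, x) \<in> V" if "(y, x') \<in> V" "(x', x) \<in> r" for x x' y
    using that tr unfolding V_def by blast
  have Uh: "(x, h x) \<in> U" if "x \<in> Field r" for x
    using that rr ss h unfolding U_def by blast
  have Vk: "(y, k y) \<in> V" if "y \<in> Field s" for y
    using that rr ss k unfolding V_def by blast
  have UF: "x \<in> Field r" "y \<in> Field s" if "(x, y) \<in> U" for x y
    using that unfolding U_def Field_def by auto
  have VF: "y \<in> Field s" "x \<in> Field r" if "(y, x) \<in> V" for x y
    using that unfolding V_def Field_def by auto
  define R :: "('a + 'b) rel" where
    "R = map_prod Inl Inl ` r \<union> map_prod Inr Inr ` s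
       \<union> map_prod Inl Inr ` U \<union> map_prod Inr Inl ` V"
  have R [simp]:
    "(Inl x, Inl x') \<in> R \<longleftrightarrow> (x, x') \<in> r"
    "(Inr y, Inr y') \<in> R \<longleftrightarrow> (y, y') \<in> s"
    "(Inl x, Inr y) \<in> R \<longleftrightarrow> (x, y) \<in> U"
    "(Inr y, Inl x) \<in> R \<longleftrightarrow> (y, x) \<in> V" for x x' y y'
    unfolding R_def by force+
  have FR: "Field R = Inl ` Field r \<union> Inr ` Field s"
  proof
    show "Field R \<subseteq> Inl ` Field r \<union> Inr ` Field s"
    proof
      fix z assume "z \<in> Field R"
      then obtain w where "(z, w) \<in> R \<or> (w, z) \<in> R"
        unfolding Field_def by blast
      then show "z \<in> Inl ` Field r \<union> Inr ` Field s"
        by (cases z; cases w) (auto dest: UF VF FieldI1 FieldI2)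
    qed
    have "(z, z) \<in> R" if "z \<in> Inl ` Field r \<union> Inr ` Field s" for z
      using that rr ss by auto
    then show "Inl ` Field r \<union> Inr ` Field s \<subseteq> Field R"
      by (blast intro: FieldI1)
  qed
  have reflR: "(z, z) \<in> R" if "z \<in> Field R" for z
    using that rr ss unfolding FR by auto
  have "trans R"
  proof (rule transI)
    fix a b c assume "(a, b) \<in> R" "(b, c) \<in> R"
    then show "(a, c) \<in> R"
      by (cases a; cases b; cases c) (simp_all, (metis tr ts UV VU U1 U2 V1 V2)+)
  qed
  then have PR: "Preorder R"
    using reflR unfolding preorder_on_def refl_on_def by (auto simp: Field_def)
  have restr: "Field (Restr R C) = C" if "C \<subseteq> Field R" for C
    using Refl_Field_Restr2[OF _ that] PR by (simp add: preorder_on_def)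
  note PR
  moreover have "cofinal_in (Inl ` Field r) R"
    unfolding cofinal_in_def FR using rr Vk k by fastforce
  moreover have "cofinal_in (Inr ` Field s) R"
    unfolding cofinal_in_def FR using ss Uh h by fastforce
  moreover have "order_isomorphic r (Restr R (Inl ` Field r))"
    unfolding order_isomorphic_def
  proof (intro exI conjI ballI)
    show "bij_betw Inl (Field r) (Field (Restr R (Inl ` Field r)))"
      by (simp add: restr FR bij_betw_def)
  qed auto
  moreover have "order_isomorphic s (Restr R (Inr ` Field s))"
    unfolding order_isomorphic_def
  proof (intro exI conjI ballI)
    show "bij_betw Inr (Field s) (Field (Restr R (Inr ` Field s)))"
      by (simp add: restr FR bij_betw_def)
  qed auto
  ultimately show ?thesis
    unfolding cofinally_equivalent_def by (intro exI conjI)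
qed

text \<open>
  A monotone map \<open>f\<close> with cofinal image has a Tukey map \<open>f'\<close> as companion, which picks for each
  \<open>y\<close> some \<open>f' y\<close> with \<open>y \<le> f (f' y)\<close>; then \<open>f' y \<le> x\<close> implies \<open>y \<le> f x\<close>. By directedness there are upper
  bounds \<open>h x\<close> of \<open>f x\<close> and \<open>g' x\<close>, where \<open>g'\<close> is the companion of \<open>g\<close>, and symmetrically
  \<open>k y\<close>; these satisfy the exchange conditions.
\<close>

lemma cofinally_equivalent_if_mono_cofinal_maps:
  assumes r: "Preorder r" and s: "Preorder s" and dr: "directed r" and ds: "directed s"
    and fmono: "\<And>x x'. (x, x') \<in> r \<Longrightarrow> (f x, f x') \<in> s"
    and fcof: "cofinal_in (f ` Field r) s"
    and gmono: "\<And>y y'. (y, y') \<in> s \<Longrightarrow> (g y, g y') \<in> r"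
    and gcof: "cofinal_in (g ` Field s) r"
  shows "cofinally_equivalent r s"
proof -
  have tr: "(x, z) \<in> r" if "(x, y) \<in> r" "(y, z) \<in> r" for x y z
    using r that by (auto simp: preorder_on_def dest: transD)
  have ts: "(x, z) \<in> s" if "(x, y) \<in> s" "(y, z) \<in> s" for x y z
    using s that by (auto simp: preorder_on_def dest: transD)
  have "\<forall>y\<in>Field s. \<exists>x\<in>Field r. (y, f x) \<in> s"
    using fcof unfolding cofinal_in_def by blast
  then obtain f' where f': "\<And>y. y \<in> Field s \<Longrightarrow> f' y \<in> Field r \<and> (y, f (f' y)) \<in> s"
    by metis
  have "\<forall>x\<in>Field r. \<exists>y\<in>Field s. (x, g y) \<in> r"
    using gcof unfolding cofinal_in_def by blast
  then obtain g' where g': "\<And>x. x \<in> Field r \<Longrightarrow> g' x \<in> Field s \<and> (x, g (g' x)) \<in> r"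
    by metis
  have "\<forall>x\<in>Field r. \<exists>z. (f x, z) \<in> s \<and> (g' x, z) \<in> s"
    using ds fcof g' unfolding directed_def cofinal_in_def by blast
  then obtain h where h: "\<And>x. x \<in> Field r \<Longrightarrow> (f x, h x) \<in> s \<and> (g' x, h x) \<in> s"
    by metis
  have "\<forall>y\<in>Field s. \<exists>z. (g y, z) \<in> r \<and> (f' y, z) \<in> r"
    using dr gcof f' unfolding directed_def cofinal_in_def by blast
  then obtain k where k: "\<And>y. y \<in> Field s \<Longrightarrow> (g y, k y) \<in> r \<and> (f' y, k y) \<in> r"
    by metis
  show ?thesis
  proof (rule cofinally_equivalent_if_exchange[OF r s, where h = h and k = k])
    show "h x \<in> Field s" if "x \<in> Field r" for x
      using h[OF that] by (auto simp: Field_def)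
    show "k y \<in> Field r" if "y \<in> Field s" for y
      using k[OF that] by (auto simp: Field_def)
    show "(x, k y) \<in> r" if x: "x \<in> Field r" and xy: "(h x, y) \<in> s" for x y
    proof -
      have "(g' x, y) \<in> s"
        using h[OF x] xy ts by blast
      then have "(g (g' x), g y) \<in> r" "y \<in> Field s"
        by (auto intro: gmono simp: Field_def)
      then show ?thesis
        using g'[OF x] k tr by blast
    qed
    show "(y, h x) \<in> s" if y: "y \<in> Field s" and xy: "(k y, x) \<in> r" for x y
    proof -
      have "(f' y, x) \<in> r"
        using k[OF y] xy tr by blast
      then have "(f (f' y), f x) \<in> s" "x \<in> Field r"
        by (auto intro: fmono simp: Field_def)
      then show ?thesis
        using f'[OF y] h ts by blast
    qed
  qed
qed

section \<open>Products and powers of directed preorders\<close>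

lemma Field_prod_order:
  assumes "Preorder r" "Preorder s"
  shows "Field (prod_order r s) = Field r \<times> Field s"
proof
  show "Field (prod_order r s) \<subseteq> Field r \<times> Field s"
    unfolding prod_order_def Field_def by auto
  have "(z, z) \<in> prod_order r s" if "z \<in> Field r \<times> Field s" for z
    using that assms by (auto simp: prod_order_def preorder_on_def refl_on_def)
  then show "Field r \<times> Field s \<subseteq> Field (prod_order r s)"
    by (blast intro: FieldI1)
qed

lemma Preorder_prod_order:
  assumes "Preorder r" "Preorder s"
  shows "Preorder (prod_order r s)"
proof -
  have "trans (prod_order r s)"
    using assms unfolding preorder_on_def trans_def prod_order_def by blast
  moreover have "(z, z) \<in> prod_order r s" if "z \<in> Field (prod_order r s)" for z
    using that assms unfolding Field_prod_order[OF assms]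
    by (auto simp: prod_order_def preorder_on_def refl_on_def)
  ultimately show ?thesis
    unfolding preorder_on_def refl_on_def by (auto simp: Field_def)
qed

lemma directed_prod_order:
  assumes "Preorder r" "Preorder s" "directed r" "directed s"
  shows "directed (prod_order r s)"
  unfolding directed_def Field_prod_order[OF assms(1,2)]
proof (intro ballI)
  fix z z' assume "z \<in> Field r \<times> Field s" "z' \<in> Field r \<times> Field s"
  then obtain u v where "(fst z, u) \<in> r" "(fst z', u) \<in> r" "(snd z, v) \<in> s" "(snd z', v) \<in> s"
    using assms(3,4) unfolding directed_def by (metis mem_Times_iff)
  then show "\<exists>w. (z, w) \<in> prod_order r s \<and> (z', w) \<in> prod_order r s"
    by (intro exI[of _ "(u, v)"]) (auto simp: prod_order_def split: prod.splits)
qed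

lemma Field_power_order:
  assumes "Preorder r"
  shows "Field (power_order r) = {f. \<forall>n. f n \<in> Field r}"
proof
  show "Field (power_order r) \<subseteq> {f. \<forall>n. f n \<in> Field r}"
    unfolding power_order_def Field_def by auto
  have "(f, f) \<in> power_order r" if "\<forall>n. f n \<in> Field r" for f
    using that assms by (auto simp: power_order_def preorder_on_def refl_on_def)
  then show "{f. \<forall>n. f n \<in> Field r} \<subseteq> Field (power_order r)"
    by (blast intro: FieldI1)
qed

lemma Preorder_power_order:
  assumes "Preorder r"
  shows "Preorder (power_order r)"
proof -
  have "trans (power_order r)"
    using assms unfolding preorder_on_def trans_def power_order_def by blast
  moreover have "(f, f) \<in> power_order r" if "f \<in> Field (power_order r)" for f
    using that assms unfolding Field_power_order[OF assms]
    by (auto simp: power_order_def preorder_on_def refl_on_def)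
  ultimately show ?thesis
    unfolding preorder_on_def refl_on_def by (auto simp: Field_def)
qed

lemma directed_power_order:
  assumes "Preorder r" "directed r"
  shows "directed (power_order r)"
  unfolding directed_def
proof (intro ballI)
  fix f g assume "f \<in> Field (power_order r)" "g \<in> Field (power_order r)"
  then have "\<forall>n. \<exists>z. (f n, z) \<in> r \<and> (g n, z) \<in> r"
    using assms(2) unfolding directed_def Field_power_order[OF assms(1)] by blast
  then obtain z where "\<And>n. (f n, z n) \<in> r \<and> (g n, z n) \<in> r"
    by metis
  then show "\<exists>z. (f, z) \<in> power_order r \<and> (g, z) \<in> power_order r"
    unfolding power_order_def by blast
qed

section \<open>Filters ordered by reverse inclusion\<close>

lemma filter_sets_mono: "A \<in> filter_sets F \<Longrightarrow> A \<subseteq> B \<Longrightarrow> B \<in> filter_sets F"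
  unfolding filter_sets_def by (auto elim: eventually_mono)

lemma filter_sets_Int: "A \<in> filter_sets F \<Longrightarrow> B \<in> filter_sets F \<Longrightarrow> A \<inter> B \<in> filter_sets F"
  unfolding filter_sets_def by (auto simp: eventually_conj_iff)

lemma filter_sets_INT:
  assumes "finite I" "\<And>i. i \<in> I \<Longrightarrow> A i \<in> filter_sets F"
  shows "(\<Inter>i\<in>I. A i) \<in> filter_sets F"
  using assms unfolding filter_sets_def by (auto simp: eventually_ball_finite)

lemma mem_filter_order:
  "(A, B) \<in> filter_order F \<longleftrightarrow> A \<in> filter_sets F \<and> B \<in> filter_sets F \<and> B \<subseteq> A"
  unfolding filter_order_def relation_of_def by auto

lemma Field_filter_order: "Field (filter_order F) = filter_sets F"
  unfolding Field_def by (auto simp: mem_filter_order)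

lemma Preorder_filter_order: "Preorder (filter_order F)"
  unfolding preorder_on_def refl_on_def trans_def Field_filter_order
  by (auto simp: mem_filter_order)

lemma directed_filter_order: "directed (filter_order F)"
  unfolding directed_def Field_filter_order
proof (intro ballI)
  fix A B assume "A \<in> filter_sets F" "B \<in> filter_sets F"
  then show "\<exists>C. (A, C) \<in> filter_order F \<and> (B, C) \<in> filter_order F"
    by (intro exI[of _ "A \<inter> B"]) (simp add: mem_filter_order filter_sets_Int)
qed

text \<open>
  Each point outside the kernel \<open>K\<close> is missed by some member of \<open>F\<close>. If \<open>A\<close> were finite,
  intersecting it with finitely many such members would put \<open>K\<close> itself into \<open>F\<close>, which would
  then be generated by it.
\<close>

lemma infinite_if_nonprincipal:
  assumes "nonprincipal F" "A \<in> filter_sets F"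
  shows "infinite A"
proof
  let ?K = "\<Inter>(filter_sets F)"
  assume fin: "finite A"
  have "\<forall>x\<in>A - ?K. \<exists>B\<in>filter_sets F. x \<notin> B"
    by blast
  then obtain B where B: "\<And>x. x \<in> A - ?K \<Longrightarrow> B x \<in> filter_sets F \<and> x \<notin> B x"
    by metis
  have "A \<inter> (\<Inter>x\<in>A - ?K. B x) \<in> filter_sets F"
    using assms(2) fin B by (intro filter_sets_Int filter_sets_INT) auto
  moreover have "A \<inter> (\<Inter>x\<in>A - ?K. B x) \<subseteq> ?K"
    using B by blast
  ultimately have K: "?K \<in> filter_sets F"
    by (rule filter_sets_mono)
  have "eventually P F \<longleftrightarrow> (\<forall>x\<in>?K. P x)" for P
  proof
    assume "eventually P F"
    then have "{x. P x} \<in> filter_sets F"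
      by (simp add: filter_sets_def)
    then show "\<forall>x\<in>?K. P x"
      by blast
  next
    assume "\<forall>x\<in>?K. P x"
    then have "{x. P x} \<in> filter_sets F"
      by (intro filter_sets_mono[OF K]) blast
    then show "eventually P F"
      by (simp add: filter_sets_def)
  qed
  then have "F = principal ?K"
    by (simp add: filter_eq_iff eventually_principal)
  then show False
    using assms(1) unfolding nonprincipal_def by blast
qed

section \<open>The Fubini product\<close>

definition large_sections :: "(nat \<times> nat \<Rightarrow> nat) \<Rightarrow> nat filter \<Rightarrow> nat set \<Rightarrow> nat set" where
  "large_sections p G E = {i. section_at p E i \<in> filter_sets G}"

definition set_of_sections :: "(nat \<times> nat \<Rightarrow> nat) \<Rightarrow> nat set \<Rightarrow> (nat \<Rightarrow> nat set) \<Rightarrow> nat set" where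
  "set_of_sections p A B = p ` (SIGMA i:A. B i)"

definition tail_union ::
  "(nat \<times> nat \<Rightarrow> nat) \<Rightarrow> nat filter \<Rightarrow> nat set \<Rightarrow> nat \<Rightarrow> nat set" where
  "tail_union p G E n = (\<Union>i\<in>large_sections p G E \<inter> {n..}. section_at p E i)"

lemma mem_filter_sets_fubini_product:
  "E \<in> filter_sets (fubini_product p F G) \<longleftrightarrow> large_sections p G E \<in> filter_sets F"
  by (simp add: filter_sets_fubini_product large_sections_def)

lemma section_at_set_of_sections:
  assumes "inj p"
  shows "section_at p (set_of_sections p A B) i = (if i \<in> A then B i else {})"
  by (simp add: section_at_def set_of_sections_def inj_image_mem_iff[OF assms])

lemma set_of_sections_in_fubini_product:
  assumes "inj p" "A \<in> filter_sets F" "\<And>i. B i \<in> filter_sets G"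
  shows "set_of_sections p A B \<in> filter_sets (fubini_product p F G)"
  unfolding mem_filter_sets_fubini_product
  by (rule filter_sets_mono[OF assms(2)])
    (auto simp: large_sections_def section_at_set_of_sections[OF assms(1)] assms(3))

lemma section_at_mono: "E \<subseteq> E' \<Longrightarrow> section_at p E i \<subseteq> section_at p E' i"
  unfolding section_at_def by auto

lemma large_sections_mono: "E \<subseteq> E' \<Longrightarrow> large_sections p G E \<subseteq> large_sections p G E'"
  unfolding large_sections_def using filter_sets_mono[OF _ section_at_mono] by auto

lemma tail_union_mono:
  assumes "E \<subseteq> E'"
  shows "tail_union p G E n \<subseteq> tail_union p G E' n"
  using large_sections_mono[OF assms, of p G] section_at_mono[OF assms, of p]
  unfolding tail_union_def by blast

lemma tail_union_in_filter_sets: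
  assumes "nonprincipal F" "E \<in> filter_sets (fubini_product p F G)"
  shows "tail_union p G E n \<in> filter_sets G"
proof -
  have "infinite (large_sections p G E)"
    using assms by (intro infinite_if_nonprincipal) (simp_all add: mem_filter_sets_fubini_product)
  then have "\<not> large_sections p G E \<subseteq> {..<n}"
    using finite_subset by blast
  then obtain i where i: "i \<in> large_sections p G E" "n \<le> i"
    by (meson lessThan_iff not_less subsetI)
  show ?thesis
  proof (rule filter_sets_mono)
    show "section_at p E i \<in> filter_sets G"
      using i by (simp add: large_sections_def)
    show "section_at p E i \<subseteq> tail_union p G E n"
      using i unfolding tail_union_def by blast
  qed
qed

text \<open>
  The sections outside \<open>A\<close> are empty, and a proper filter keeps them from being large.
\<close>

lemma large_sections_set_of_sections:
  assumes "inj p" "{} \<notin> filter_sets G" "\<And>i. B i \<in> filter_sets G"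
  shows "large_sections p G (set_of_sections p A B) = A"
  using assms(2,3)
  by (auto simp: large_sections_def section_at_set_of_sections[OF assms(1)])

theorem lemma5p1:
  fixes p :: "nat \<times> nat \<Rightarrow> nat" and F G :: "nat filter"
  assumes "bij p" and "nonprincipal F" and "nonprincipal G"
  shows "cofinally_equivalent
           (filter_order (fubini_product p F G))
           (prod_order (filter_order F) (power_order (filter_order G)))"
proof -
  let ?P = "filter_order (fubini_product p F G)"
  let ?Q = "prod_order (filter_order F) (power_order (filter_order G))"
  let ?f = "\<lambda>E. (large_sections p G E, tail_union p G E)"
  let ?g = "\<lambda>(A, B). set_of_sections p A B"
  have inj: "inj p"
    using assms(1) by (rule bij_is_inj)
  have G: "{} \<notin> filter_sets G"
    using infinite_if_nonprincipal[OF assms(3)] by blast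
  note pre = Preorder_filter_order Preorder_power_order[OF Preorder_filter_order]
  note dir = directed_filter_order
    directed_power_order[OF Preorder_filter_order directed_filter_order]
  have memQ: "((A, B), (A', B')) \<in> ?Q \<longleftrightarrow>
      A \<in> filter_sets F \<and> A' \<in> filter_sets F \<and> A' \<subseteq> A \<and>
      (\<forall>n. B n \<in> filter_sets G \<and> B' n \<in> filter_sets G \<and> B' n \<subseteq> B n)" for A A' B B'
    by (auto simp: prod_order_def power_order_def mem_filter_order)
  have FQ: "Field ?Q = filter_sets F \<times> {B. \<forall>n. B n \<in> filter_sets G}"
    by (simp add: Field_prod_order[OF pre] Field_power_order[OF Preorder_filter_order]
        Field_filter_order)
  have f_in: "?f E \<in> Field ?Q" if "E \<in> filter_sets (fubini_product p F G)" for E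
    using that assms(2) by (simp add: FQ mem_filter_sets_fubini_product tail_union_in_filter_sets)
  have g_in: "?g z \<in> filter_sets (fubini_product p F G)" if "z \<in> Field ?Q" for z
    using that by (auto simp: FQ set_of_sections_in_fubini_product[OF inj])
  show ?thesis
  proof (rule cofinally_equivalent_if_mono_cofinal_maps[where f = ?f and g = ?g])
    show "Preorder ?P" "Preorder ?Q" "directed ?P" "directed ?Q"
      by (intro Preorder_filter_order Preorder_prod_order pre directed_filter_order
          directed_prod_order dir)+
    show "(?f E, ?f E') \<in> ?Q" if "(E, E') \<in> ?P" for E E'
    proof -
      have E: "E \<in> filter_sets (fubini_product p F G)" "E' \<in> filter_sets (fubini_product p F G)"
        and sub: "E' \<subseteq> E"
        using that by (simp_all add: mem_filter_order)
      show ?thesis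
        using f_in[OF E(1)] f_in[OF E(2)] large_sections_mono[OF sub] tail_union_mono[OF sub]
        by (simp add: memQ FQ)
    qed
    show "(?g z, ?g z') \<in> ?P" if "(z, z') \<in> ?Q" for z z'
    proof -
      have "?g z' \<subseteq> ?g z"
        using that by (cases z; cases z') (auto simp: memQ set_of_sections_def)
      moreover note FieldI1[OF that] FieldI2[OF that]
      ultimately show ?thesis
        using g_in by (simp only: mem_filter_order simp_thms)
    qed
    show "cofinal_in (?f ` Field ?P) ?Q"
      unfolding cofinal_in_def
    proof (intro conjI ballI)
      show "?f ` Field ?P \<subseteq> Field ?Q"
        using f_in unfolding Field_filter_order by blast
      fix z assume z: "z \<in> Field ?Q"
      obtain A C where AC: "z = (A, C)" "A \<in> filter_sets F" "\<And>n. C n \<in> filter_sets G"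
        using z by (auto simp: FQ)
      define D where "D i = (\<Inter>n\<in>{..i}. C n)" for i
      have D: "D i \<in> filter_sets G" for i
        unfolding D_def by (intro filter_sets_INT AC) auto
      let ?E = "set_of_sections p A D"
      have E: "?E \<in> filter_sets (fubini_product p F G)"
        by (rule set_of_sections_in_fubini_product[OF inj AC(2) D])
      have "tail_union p G ?E n \<subseteq> C n" for n
        unfolding tail_union_def section_at_set_of_sections[OF inj]
        by (auto simp: D_def split: if_splits)
      then have "(z, ?f ?E) \<in> ?Q"
        using AC f_in[OF E]
        by (simp add: memQ FQ large_sections_set_of_sections[OF inj G D])
      then show "\<exists>c\<in>?f ` Field ?P. (z, c) \<in> ?Q"
        using E unfolding Field_filter_order by blast
    qed
    show "cofinal_in (?g ` Field ?Q) ?P"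
      unfolding cofinal_in_def
    proof (intro conjI ballI)
      show "?g ` Field ?Q \<subseteq> Field ?P"
        using g_in unfolding Field_filter_order by blast
      fix E assume "E \<in> Field ?P"
      then have E: "E \<in> filter_sets (fubini_product p F G)"
        by (simp add: Field_filter_order)
      let ?A = "large_sections p G E"
      \<comment> \<open>The value \<open>UNIV\<close> off \<open>?A\<close> only keeps the sequence inside \<open>G\<close>; those sections are
        discarded by \<open>set_of_sections\<close>.\<close>
      let ?B = "\<lambda>i. if i \<in> ?A then section_at p E i else UNIV"
      have UNIV: "UNIV \<in> filter_sets G"
        by (simp add: filter_sets_def)
      have z: "(?A, ?B) \<in> Field ?Q"
        using E UNIV by (auto simp: FQ mem_filter_sets_fubini_product large_sections_def)
      have "?g (?A, ?B) \<subseteq> E"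
        by (auto simp: set_of_sections_def section_at_def)
      then have "(E, ?g (?A, ?B)) \<in> ?P"
        using E g_in[OF z] by (simp add: mem_filter_order)
      then show "\<exists>c\<in>?g ` Field ?Q. (E, c) \<in> ?P"
        using z by blast
    qed
  qed
qed

end
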